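(* Let $N\in\mathbb N^+$, let $\Lambda=\bigcup_{r=1}^{N}\Lambda_r\subset(0,1)$ with each $\Lambda_r$ ($1\le r\le N$) a Carleson sequence, and let $p>0$. Then, for every $0<\eta<1$, there exists a partition $$\Lambda=\mathop{\dot\bigcup}_{n\in\mathbb N^+}\sigma_n,\qquad \sigma_n=\{\lambda_{n,1},\ldots,\lambda_{n,m_n}\},$$ such that, upon setting $\sigma_n^p:=\{\lambda_{n,1}^p,\ldots,\lambda_{n,m_n}^p\}$, one has $$\Lambda^p=\mathop{\dot\bigcup}_{n\in\mathbb N^+}\sigma_n^p,\qquad \Lambda^p:=\{\lambda^p:\lambda\in\Lambda\},$$ and such that both partitions (that is, $(\Gamma,(\tau_n)_{n\in\mathbb N^+})=(\Lambda,(\sigma_n)_{n\in\mathbb N^+})$ and $(\Gamma,(\tau_n)_{n\in\mathbb N^+})=(\Lambda^p,(\sigma_n^p)_{n\in\mathbb N^+})$) satisfy the following properties: (i) each $\tau_n$ is finite and $\sup_{n\in\mathbb N^+}|\tau_n|\le N$; (ii) for every $n\in\mathbb N^+$ and all distinct $\lambda,\mu\in\tau_n$, $\rho(\lambda,\mu)<\eta$; (iii) there exists a constant $\delta>0$ such that, for every choice of points $\lambda_n^0\in\tau_n$ ($n\in\mathbb N^+$), the sequence $\Gamma_0=\{\lambda_n^0:n\in\mathbb N^+\}$ is a Carleson sequence and satisfies $\delta_{\Gamma_0}\ge\delta$; (iv) there exist a constant $M_D<\infty$ and functions $D_n\in H^\infty(\mathbb D)$, $n\in\mathbb N^+$, such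 that $D_n(\lambda)=1$ for $\lambda\in\tau_n$, $D_n(\lambda)=0$ for $\lambda\in\Gamma\setminus\tau_n$, and $\sum_{n\in\mathbb N^+}|D_n(z)|\le M_D$ for all $z\in\mathbb D$. The constants occurring in (iii) and (iv) may be different for the two partitions; the parameter $\eta$ in (ii) is the prescribed one for both.
   Context: $\mathbb N^+=\{1,2,\dots\}$, $\mathbb D=\{z\in\mathbb C:|z|<1\}$, and $H^\infty(\mathbb D)$ is the space of bounded analytic functions on $\mathbb D$. For $\lambda,z\in\mathbb D$, $\rho(\lambda,z)=\left|\frac{\lambda-z}{1-\overline\lambda z}\right|$ is the pseudo-hyperbolic distance. A (countably infinite) sequence $\Lambda=\{\lambda_j\}_{j}\subset\mathbb D$ of pairwise distinct points is a Carleson sequence, written $\Lambda\in\mathcal C$, if $\delta_\Lambda:=\inf_{j}\prod_{i\ne j}\rho(\lambda_i,\lambda_j)>0$. All sequences are infinite unless stated otherwise. Unions of sequences are unions of the underlying sets; $\mathop{\dot\bigcup}$ denotes a disjoint union, the sets $\sigma_n$ being nonempty, and $\lambda_{n,1},\dots,\lambda_{n,m_n}$ are pairwise distinct. $|E|$ denotes the cardinality of a finite set $E$. *)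

theory Defs
  imports "HOL-Complex_Analysis.Complex_Analysis"
begin

definition rho :: "complex \<Rightarrow> complex \<Rightarrow> real" where
  "rho w z = cmod ((w - z) / (1 - cnj w * z))"

definition Hinf :: "(complex \<Rightarrow> complex) set" where
  "Hinf = {f. f holomorphic_on ball 0 1 \<and> bounded (f ` ball 0 1)}"

(* The infinite product is the limit of the partial products, which exists for every
   sequence in the disc (carleson_prod_LIMSEQ below) but may be 0.  The library's prodinf
   is not used because its value is unspecified for products that diverge to 0. *)
definition carleson_prod :: "(nat \<Rightarrow> complex) \<Rightarrow> nat \<Rightarrow> real" where
  "carleson_prod s j = lim (\<lambda>n. \<Prod>i\<in>{..<n} - {j}. rho (s i) (s j))"

definition carleson_const :: "(nat \<Rightarrow> complex) \<Rightarrow> real" where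
  "carleson_const s = (INF j. carleson_prod s j)"

definition carleson :: "(nat \<Rightarrow> complex) \<Rightarrow> bool" where
  "carleson s \<longleftrightarrow> range s \<subseteq> ball 0 1 \<and> inj s \<and> carleson_const s > 0"

(* Blocks are indexed by nat instead of the positive integers. *)
definition partition_into :: "complex set \<Rightarrow> (nat \<Rightarrow> complex set) \<Rightarrow> bool" where
  "partition_into G \<tau> \<longleftrightarrow> (\<forall>n. \<tau> n \<noteq> {}) \<and> disjoint_family \<tau> \<and> G = (\<Union>n. \<tau> n)"

definition blocks_card_le :: "nat \<Rightarrow> (nat \<Rightarrow> complex set) \<Rightarrow> bool" where
  "blocks_card_le N \<tau> \<longleftrightarrow> (\<forall>n. finite (\<tau> n) \<and> card (\<tau> n) \<le> N)"

definition blocks_rho_less :: "real \<Rightarrow> (nat \<Rightarrow> complex set) \<Rightarrow> bool" where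
  "blocks_rho_less \<eta> \<tau> \<longleftrightarrow> (\<forall>n. \<forall>w\<in>\<tau> n. \<forall>z\<in>\<tau> n. w \<noteq> z \<longrightarrow> rho w z < \<eta>)"

definition uniformly_carleson_selections :: "(nat \<Rightarrow> complex set) \<Rightarrow> bool" where
  "uniformly_carleson_selections \<tau> \<longleftrightarrow>
     (\<exists>\<delta>>0. \<forall>c. (\<forall>n. c n \<in> \<tau> n) \<longrightarrow> carleson c \<and> carleson_const c \<ge> \<delta>)"

definition has_block_functions :: "complex set \<Rightarrow> (nat \<Rightarrow> complex set) \<Rightarrow> bool" where
  "has_block_functions G \<tau> \<longleftrightarrow>
     (\<exists>(M::real) D. (\<forall>n. D n \<in> Hinf \<and> (\<forall>w\<in>\<tau> n. D n w = 1) \<and> (\<forall>w\<in>G - \<tau> n. D n w = 0)) \<and>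
        (\<forall>z\<in>ball 0 1. summable (\<lambda>n. cmod (D n z)) \<and> (\<Sum>n. cmod (D n z)) \<le> M))"

(* On the positive reals the principal branch agrees with the real power (powr_of_real). *)
definition cpow :: "real \<Rightarrow> complex \<Rightarrow> complex" where
  "cpow p z = z powr complex_of_real p"

lemma rho_le_1:
  assumes "w \<in> ball 0 1" "z \<in> ball 0 1"
  shows "rho w z \<le> 1"
proof -
  have "cmod (Moebius_function 0 w z) < 1"
    using assms by (intro Moebius_function_norm_lt_1) auto
  then show ?thesis
    by (simp add: rho_def Moebius_function_simple norm_divide norm_minus_commute)
qed

lemma carleson_prod_LIMSEQ:
  assumes "range s \<subseteq> ball 0 1"
  shows "(\<lambda>n. \<Prod>i\<in>{..<n} - {j}. rho (s i) (s j)) \<longlonglongrightarrow> carleson_prod s j"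
proof -
  let ?P = "\<lambda>n. \<Prod>i\<in>{..<n} - {j}. rho (s i) (s j)"
  have nonneg: "0 \<le> ?P n" for n
    by (intro prod_nonneg) (simp add: rho_def)
  have "?P (Suc n) \<le> ?P n" for n
  proof (cases "n = j")
    case True
    then have "{..<Suc n} - {j} = {..<n} - {j}" by auto
    then show ?thesis by simp
  next
    case False
    then have "{..<Suc n} - {j} = insert n ({..<n} - {j})" by auto
    then have "?P (Suc n) = rho (s n) (s j) * ?P n" by simp
    also have "\<dots> \<le> 1 * ?P n"
      using assms nonneg by (intro mult_right_mono rho_le_1) blast+
    finally show ?thesis by simp
  qed
  then have "decseq ?P" by (rule decseq_SucI)
  then have "convergent ?P"
    using nonneg decseq_convergent[of ?P 0] by (metis convergentI)
  then show ?thesis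
    by (simp add: carleson_prod_def convergent_LIMSEQ_iff)
qed

end

theory Submission
  imports Defs
begin

text \<open>
Write a point of the interval from 0 to 1 as \<open>exp (- a)\<close> with \<open>a > 0\<close>. The map
\<open>\<lambda> \<mapsto> \<lambda> powr p\<close> then becomes \<open>a \<mapsto> p * a\<close>, which preserves ratios, and as long as \<open>a\<close>
is bounded the pseudo-hyperbolic geometry is controlled by ratios: for \<open>a < b\<close> the distance of the two
points is at most \<open>b / a - 1\<close>, it is bounded below when \<open>b / a\<close> is bounded away from 1, and it
differs from 1 by at most a constant times \<open>a / b\<close> (\<open>rho_expneg_le\<close>, \<open>rho_expneg_ge\<close>, \<open>one_minus_rho_expneg_le\<close>).
It therefore suffices to partition the parameters by a condition on ratios: blocks of at most \<open>N\<close>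
points, with ratios below \<open>1 + \<eta>\<close> inside a block and at least some \<open>q > 1\<close> between different
blocks (locale \<open>log_blocks\<close>). Scaling by \<open>p\<close> preserves this, so the conclusions hold for both partitions.

Such blocks exist (\<open>exists_log_blocks\<close>). A Carleson sequence on the radius is separated, so in each of the \<open>N\<close>
parameter sets consecutive ratios are at least \<open>1 + \<delta>\<close>, and at most \<open>N\<close> points of the union fit into
any window of ratio less than \<open>1 + \<delta>\<close>. Cutting the union at gaps of ratio \<open>q\<close>, with \<open>q ^ N\<close> below
\<open>1 + \<delta>\<close> and \<open>1 + \<eta>\<close>, leaves clusters that fit into such windows.

Choosing one point from each block gives a set with ratios at least \<open>q\<close>, over which
\<open>min (a / s) (s / a)\<close> has a bounded sum, uniformly in \<open>s > 0\<close> (\<open>sum_ratio_kernel_lacunary_le\<close>). With \<open>s\<close> the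
parameter of a point this bounds the sum of \<open>1 - rho\<close>, so all products of distances to points of
other blocks are bounded below (\<open>prod_rho_other_blocks_ge\<close>). That yields the Carleson property of
selections, and Blaschke products that vanish on all other blocks but stay away from 0 on
the given one.

For the functions \<open>D n\<close>, these Blaschke products are multiplied by the explicit functions
\<open>(1 - l) * (1 - z) / (1 - l * z)\<^sup>2\<close> with \<open>l = exp (- a)\<close>, which are at least 1/4 at \<open>z = l\<close> and on the whole disc bounded by
a constant times \<open>min (a / s) (s / a)\<close> with \<open>s = cmod (1 - z)\<close> (\<open>cmod_peak_le\<close>); so their moduli have a
bounded sum. After normalisation this gives a function \<open>F b\<close> for each point \<open>b\<close> of the block, equal to 1 there and
vanishing on the other blocks, and \<open>1 - (\<Prod>b. 1 - F b)\<close> is 1 on the entire block, without any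
condition on the mutual distances inside it (\<open>block_functions\<close>).
\<close>

section \<open>Kernel sums over lacunary sets\<close>

text \<open>
This is \<open>exp (- \<bar>ln a - ln s\<bar>)\<close>. All quantities to be summed later decay
exponentially in the logarithmic distance, hence are bounded by this kernel.
\<close>
definition ratio_kernel :: "real \<Rightarrow> real \<Rightarrow> real" where
  "ratio_kernel a s = min (a / s) (s / a)"

lemma ratio_kernel_nonneg: "0 < a \<Longrightarrow> 0 < s \<Longrightarrow> 0 \<le> ratio_kernel a s"
  by (simp add: ratio_kernel_def)

lemma ratio_kernel_le_1: "0 < a \<Longrightarrow> 0 < s \<Longrightarrow> ratio_kernel a s \<le> 1"
  by (cases "a \<le> s") (auto simp: ratio_kernel_def min_le_iff_disj)

lemma ratio_kernel_commute: "ratio_kernel a s = ratio_kernel s a"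
  by (simp add: ratio_kernel_def min.commute)

lemma ratio_kernel_comparable:
  assumes "0 < a" "0 < c" "0 < s" "a \<le> 2 * c" "c \<le> 2 * a"
  shows "ratio_kernel a s \<le> 2 * ratio_kernel c s"
proof -
  have "a / s \<le> 2 * (c / s)" using assms by (simp add: field_simps)
  moreover have "s / a \<le> 2 * (s / c)" using assms by (simp add: field_simps)
  ultimately show ?thesis by (auto simp: ratio_kernel_def min_def)
qed

text \<open>
The sum is dominated by the geometric series that descends from its largest term. Adding
points from below to above makes the induction close: below a new maximum \<open>b\<close>, all
points are at most \<open>b / q\<close>.
\<close>
lemma sum_lacunary_le:
  fixes F :: "real set"
  assumes "finite F" "1 < q" "0 \<le> s"
    and "\<And>a. a \<in> F \<Longrightarrow> a \<le> s"
    and "\<And>a b. a \<in> F \<Longrightarrow> b \<in> F \<Longrightarrow> a < b \<Longrightarrow> q * a \<le> b"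
    and "\<And>a. a \<in> F \<Longrightarrow> 0 < a"
  shows "(\<Sum>a\<in>F. a) \<le> s * (q / (q - 1))"
  using assms(1,3-)
proof (induction F arbitrary: s rule: finite_linorder_max_induct)
  case empty
  then show ?case using \<open>1 < q\<close> by simp
next
  case (insert b F)
  have "0 < b" "b \<le> s" using insert.prems by auto
  have "(\<Sum>a\<in>F. a) \<le> (b / q) * (q / (q - 1))"
  proof (rule insert.IH)
    show "a \<le> b / q" if "a \<in> F" for a
      using insert.prems(3)[of a b] insert.hyps that \<open>1 < q\<close> by (simp add: field_simps)
    show "0 \<le> b / q" using \<open>0 < b\<close> \<open>1 < q\<close> by simp
  qed (use insert.prems in auto)
  also have "\<dots> = b / (q - 1)" using \<open>1 < q\<close> by simp
  finally have "b + (\<Sum>a\<in>F. a) \<le> b * (q / (q - 1))"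
    using \<open>1 < q\<close> by (simp add: field_simps)
  also have "\<dots> \<le> s * (q / (q - 1))"
    using \<open>b \<le> s\<close> \<open>1 < q\<close> by (intro mult_right_mono) auto
  finally show ?case using insert.hyps by (subst sum.insert) auto
qed

text \<open>
Points at most \<open>s\<close> contribute a geometric series in \<open>a / s\<close>; the inverses of the points above
\<open>s\<close> are again lacunary and contribute a second one. The bound depends on neither \<open>s\<close> nor
the number of points, which is what makes every later constant uniform.
\<close>
lemma sum_ratio_kernel_lacunary_le:
  fixes F :: "real set"
  assumes fin: "finite F" and q: "1 < q" and s: "0 < s"
    and gap: "\<And>a b. a \<in> F \<Longrightarrow> b \<in> F \<Longrightarrow> a < b \<Longrightarrow> q * a \<le> b"
    and pos: "\<And>a. a \<in> F \<Longrightarrow> 0 < a"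
  shows "(\<Sum>a\<in>F. ratio_kernel a s) \<le> 2 * (q / (q - 1))"
proof -
  define F1 where "F1 = {a \<in> F. a \<le> s}"
  define F2 where "F2 = {a \<in> F. s < a}"
  have F: "F = F1 \<union> F2" "F1 \<inter> F2 = {}" "finite F1" "finite F2"
    using fin by (auto simp: F1_def F2_def)
  have "(\<Sum>a\<in>F1. ratio_kernel a s) \<le> (\<Sum>a\<in>F1. a / s)"
    by (intro sum_mono) (simp add: ratio_kernel_def)
  also have "\<dots> = (\<Sum>a\<in>F1. a) / s" by (simp add: sum_divide_distrib)
  also have "\<dots> \<le> s * (q / (q - 1)) / s"
  proof (rule divide_right_mono)
    show "(\<Sum>a\<in>F1. a) \<le> s * (q / (q - 1))"
      using F gap pos q s by (intro sum_lacunary_le) (auto simp: F1_def)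
  qed (use s in simp)
  also have "\<dots> = q / (q - 1)" using s by simp
  finally have 1: "(\<Sum>a\<in>F1. ratio_kernel a s) \<le> q / (q - 1)" .
  have "(\<Sum>a\<in>F2. ratio_kernel a s) \<le> (\<Sum>a\<in>F2. s * inverse a)"
    by (intro sum_mono) (simp add: ratio_kernel_def divide_inverse)
  also have "\<dots> = s * (\<Sum>x\<in>inverse ` F2. x)"
    by (simp add: sum_distrib_left sum.reindex inj_on_def)
  also have "(\<Sum>x\<in>inverse ` F2. x) \<le> inverse s * (q / (q - 1))"
  proof (rule sum_lacunary_le)
    fix x assume "x \<in> inverse ` F2"
    then obtain a where a: "a \<in> F" "s < a" "x = inverse a" by (auto simp: F2_def)
    then show "x \<le> inverse s" "0 < x" using s by auto
    fix y assume "y \<in> inverse ` F2" "x < y"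
    then obtain b where b: "b \<in> F" "s < b" "y = inverse b" by (auto simp: F2_def)
    have "b < a" using \<open>x < y\<close> a b s by (simp add: inverse_less_iff_less)
    then have "q * b \<le> a" using gap a b by blast
    then have "q * inverse a \<le> inverse b" using a(2) b(2) s by (simp add: field_simps)
    then show "q * x \<le> y" by (simp add: a b)
  qed (use F q s in auto)
  then have "s * (\<Sum>x\<in>inverse ` F2. x) \<le> s * (inverse s * (q / (q - 1)))"
    using s by (intro mult_left_mono) auto
  also have "\<dots> = q / (q - 1)" using s by simp
  finally have 2: "(\<Sum>a\<in>F2. ratio_kernel a s) \<le> q / (q - 1)" .
  show ?thesis using 1 2 F by (simp add: sum.union_disjoint)
qed

section \<open>Pseudo-hyperbolic distance in the logarithmic parameter\<close>

text \<open>
The parametrisation of the interval from 0 to 1 in which the power map becomes multiplication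
by \<open>p\<close> and so preserves ratios.
\<close>
definition expneg :: "real \<Rightarrow> complex" where
  "expneg a = complex_of_real (exp (- a))"

lemma inj_expneg: "inj expneg"
  by (auto simp: inj_def expneg_def)

lemma expneg_in_ball: "0 < a \<Longrightarrow> expneg a \<in> ball 0 1"
  by (simp add: expneg_def)

lemma cpow_expneg: "cpow p (expneg a) = expneg (p * a)"
  unfolding cpow_def expneg_def
  by (subst powr_of_real) (auto simp: powr_def)

lemma one_minus_exp_neg_le: "1 - exp (- a) \<le> (a :: real)"
  using exp_ge_add_one_self[of "- a"] by simp

text \<open>
This is \<open>1 + a \<le> exp a\<close> divided by \<open>exp a\<close>. Together with the preceding upper bound it makes
\<open>1 - exp (- a)\<close> comparable to \<open>a\<close> on bounded sets of parameters.
\<close>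
lemma one_minus_exp_neg_ge: "a * exp (- a) \<le> 1 - exp (- a :: real)"
proof -
  have "(1 + a) * exp (- a) \<le> exp a * exp (- a)"
    using exp_ge_add_one_self[of a] by (intro mult_right_mono) auto
  then show ?thesis by (simp add: exp_minus algebra_simps)
qed

lemma rho_commute: "rho w z = rho z w"
proof -
  have "cmod (1 - cnj w * z) = cmod (cnj (1 - cnj w * z))" by (simp only: complex_mod_cnj)
  also have "\<dots> = cmod (1 - cnj z * w)" by (simp add: mult.commute)
  finally show ?thesis by (simp add: rho_def norm_divide norm_minus_commute)
qed

lemma rho_nonneg: "0 \<le> rho w z"
  by (simp add: rho_def)

lemma rho_expneg:
  assumes "0 < a" "a \<le> b"
  shows "rho (expneg a) (expneg b) = (exp (- a) - exp (- b)) / (1 - exp (- a) * exp (- b))"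
proof -
  have *: "exp (- a) * exp (- b) < 1"
    using assms by (simp flip: exp_add)
  have "(expneg a - expneg b) / (1 - cnj (expneg a) * expneg b) =
    complex_of_real ((exp (- a) - exp (- b)) / (1 - exp (- a) * exp (- b)))"
    by (simp add: expneg_def)
  then have "rho (expneg a) (expneg b) = \<bar>(exp (- a) - exp (- b)) / (1 - exp (- a) * exp (- b))\<bar>"
    unfolding rho_def by (simp only: norm_of_real)
  also have "\<dots> = (exp (- a) - exp (- b)) / (1 - exp (- a) * exp (- b))"
    using assms * by (intro abs_of_nonneg divide_nonneg_nonneg) auto
  finally show ?thesis .
qed

text \<open>
The numerator of \<open>rho\<close> is at most \<open>exp (- a) * (b - a)\<close> and the denominator at least
\<open>a * exp (- a)\<close>. The bound depends on the ratio of the parameters only: a small ratio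
forces hyperbolic closeness, and conversely hyperbolic separation forces a gap in the ratio.
\<close>
lemma rho_expneg_le:
  assumes "0 < a" "a \<le> b"
  shows "rho (expneg a) (expneg b) \<le> b / a - 1"
proof -
  have "a * exp (- a) \<le> 1 - exp (- a)" by (rule one_minus_exp_neg_ge)
  also have "exp (- a) * exp (- b) \<le> exp (- a) * 1"
    using assms by (intro mult_left_mono) auto
  then have "1 - exp (- a) \<le> 1 - exp (- a) * exp (- b)" by simp
  finally have den: "a * exp (- a) \<le> 1 - exp (- a) * exp (- b)" .
  have "exp (- a) - exp (- b) = exp (- a) * (1 - exp (- (b - a)))"
    by (simp add: algebra_simps flip: exp_add)
  also have "\<dots> \<le> exp (- a) * (b - a)"
    by (intro mult_left_mono one_minus_exp_neg_le) auto
  finally have num: "exp (- a) - exp (- b) \<le> exp (- a) * (b - a)" .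
  have "rho (expneg a) (expneg b) \<le> (exp (- a) * (b - a)) / (a * exp (- a))"
    unfolding rho_expneg[OF assms] using assms num den
    by (intro frac_le) auto
  also have "\<dots> = b / a - 1" using assms by (simp add: field_simps)
  finally show ?thesis .
qed

text \<open>
The converse direction: a gap in the ratio gives hyperbolic separation. Here the parameters
must stay bounded, that is, the points must stay away from 0, where the pseudo-hyperbolic
distance is comparable to the Euclidean one and ratios of parameters say nothing.
\<close>
lemma rho_expneg_ge:
  assumes "0 < a" "a \<le> b" "b \<le> A"
  shows "exp (- A) / 2 * (1 - a / b) \<le> rho (expneg a) (expneg b)"
proof -
  have den: "1 - exp (- a) * exp (- b) \<le> 2 * b"
    using one_minus_exp_neg_le[of "a + b"] assms by (simp add: algebra_simps flip: exp_add)
  have den0: "0 < 1 - exp (- a) * exp (- b)"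
    using assms by (simp flip: exp_add)
  have "exp (- A) * (b - a) \<le> exp (- b) * (exp (b - a) - 1)"
  proof (intro mult_mono)
    show "b - a \<le> exp (b - a) - 1" using exp_ge_add_one_self[of "b - a"] by linarith
  qed (use assms in auto)
  also have "\<dots> = exp (- a) - exp (- b)" by (simp add: algebra_simps flip: exp_add)
  finally have num: "exp (- A) * (b - a) \<le> exp (- a) - exp (- b)" .
  have "exp (- A) / 2 * (1 - a / b) = exp (- A) * (b - a) / (2 * b)"
    using assms by (simp add: field_simps)
  also have "\<dots> \<le> rho (expneg a) (expneg b)"
    unfolding rho_expneg[OF assms(1,2)] using num den den0 assms by (intro frac_le) auto
  finally show ?thesis .
qed

lemma exp_neg_mult_le:
  assumes "0 < a" "a \<le> A"
  shows "exp (- A) * a \<le> 1 - exp (- a :: real)"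
proof -
  have "exp (- A) * a \<le> exp (- a) * a" using assms by (intro mult_right_mono) auto
  then show ?thesis using one_minus_exp_neg_ge[of a] by (simp add: mult.commute)
qed

text \<open>
For \<open>a \<le> b\<close> one has the closed form
\<open>1 - rho = (1 - x) * (1 + y) / (1 - x * y)\<close> with \<open>x = exp (- a)\<close> and \<open>y = exp (- b)\<close>; the numerator is
of order \<open>a\<close> and the denominator of order \<open>b\<close>.
\<close>
lemma one_minus_rho_expneg_le:
  assumes "0 < a" "a \<le> A" "0 < b" "b \<le> A"
  shows "1 - rho (expneg a) (expneg b) \<le> 2 * exp A * ratio_kernel a b"
proof -
  have main: "1 - rho (expneg a) (expneg b) \<le> 2 * exp A * ratio_kernel a b"
    if "0 < a" "a \<le> b" "b \<le> A" for a b
  proof -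
    have xy: "exp (- a) * exp (- b) < 1" using that by (simp flip: exp_add)
    have "1 - rho (expneg a) (expneg b) =
      (1 - exp (- a)) * (1 + exp (- b)) / (1 - exp (- a) * exp (- b))"
      using xy by (simp add: rho_expneg that field_simps)
    also have "\<dots> \<le> (a * 2) / (exp (- A) * b)"
    proof (intro frac_le mult_mono)
      have "exp (- A) * b \<le> 1 - exp (- b)" using that by (intro exp_neg_mult_le) auto
      also have "exp (- a) * exp (- b) \<le> 1 * exp (- b)"
        using that by (intro mult_right_mono) auto
      then have "1 - exp (- b) \<le> 1 - exp (- a) * exp (- b)" by simp
      finally show "exp (- A) * b \<le> 1 - exp (- a) * exp (- b)" .
    qed (use that one_minus_exp_neg_le[of a] in auto)
    also have "\<dots> = 2 * exp A * (a / b)" by (simp add: exp_minus field_simps)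
    also have "a / b = ratio_kernel a b"
    proof -
      have "a / b \<le> 1" "1 \<le> b / a" using that by auto
      then have "a / b \<le> b / a" by linarith
      then show ?thesis by (simp add: ratio_kernel_def)
    qed
    finally show ?thesis .
  qed
  show ?thesis
  proof (cases "a \<le> b")
    case True
    then show ?thesis using main assms by blast
  next
    case False
    then show ?thesis using main[of b a] assms
      by (simp add: rho_commute[of "expneg a"] ratio_kernel_commute[of a])
  qed
qed

text \<open>
Turns a bound on a sum of \<open>1 - rho\<close> into a lower bound on the product of the \<open>rho\<close>,
factor by factor: \<open>- ln r \<le> 1 / r - 1 = (1 - r) / r\<close>.
\<close>
lemma exp_neg_le_of_one_minus_le:
  fixes r \<kappa> x :: real
  assumes "0 < \<kappa>" "\<kappa> \<le> r" "r \<le> 1" "1 - r \<le> x"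
  shows "exp (- (x / \<kappa>)) \<le> r"
proof -
  have "r > 0" using assms by linarith
  have "ln (1 / r) \<le> 1 / r - 1" using \<open>r > 0\<close> by (intro ln_le_minus_one) auto
  also have "\<dots> = (1 - r) / r" using \<open>r > 0\<close> by (simp add: field_simps)
  also have "\<dots> \<le> x / \<kappa>" using assms by (intro frac_le) auto
  finally have "- (x / \<kappa>) \<le> ln r" using \<open>r > 0\<close> by (simp add: ln_div)
  then show ?thesis using \<open>r > 0\<close> by (simp add: ln_ge_iff)
qed

section \<open>Blaschke factors and peak functions\<close>

definition blaschke_factor :: "real \<Rightarrow> complex \<Rightarrow> complex" where
  "blaschke_factor a z = (expneg a - z) / (1 - expneg a * z)"

lemma cmod_blaschke_factor: "cmod (blaschke_factor a z) = rho (expneg a) z"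
  by (simp add: blaschke_factor_def rho_def expneg_def)

lemma one_minus_expneg_mult_nonzero:
  assumes "0 < a" "z \<in> ball 0 1"
  shows "1 - expneg a * z \<noteq> 0"
proof
  assume "1 - expneg a * z = 0"
  then have "cmod (expneg a * z) = 1" by simp
  moreover have "cmod (expneg a * z) < 1"
  proof -
    have "exp (- a) * cmod z \<le> 1 * cmod z"
      using assms by (intro mult_right_mono) auto
    then show ?thesis using assms by (simp add: norm_mult expneg_def)
  qed
  ultimately show False by simp
qed

lemma holomorphic_blaschke_factor:
  assumes "0 < a"
  shows "blaschke_factor a holomorphic_on ball 0 1"
  unfolding blaschke_factor_def[abs_def]
  by (intro holomorphic_intros) (use one_minus_expneg_mult_nonzero[OF assms] in auto)

text \<open>
A function concentrated at the scale of \<open>expneg a\<close>: the square of the usual kernel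
\<open>(1 - l) / (1 - l * z)\<close>, which decays away from 1 but not towards 1, with one of its factors replaced
by \<open>(1 - z) / (1 - l * z)\<close>, which supplies the decay towards 1. The common zero at 1 is harmless,
since 1 lies on the boundary of the disc.
\<close>
definition peak :: "real \<Rightarrow> complex \<Rightarrow> complex" where
  "peak a z = (1 - expneg a) * (1 - z) / (1 - expneg a * z)\<^sup>2"

lemma holomorphic_peak:
  assumes "0 < a"
  shows "peak a holomorphic_on ball 0 1"
  unfolding peak_def[abs_def]
  by (intro holomorphic_intros) (use one_minus_expneg_mult_nonzero[OF assms] in auto)

text \<open>
With \<open>l = 1 - exp (- a)\<close> and \<open>s = cmod (1 - z)\<close>, the denominator satisfies
\<open>cmod (1 - expneg a * z) \<ge> max l (s / 2)\<close> on the whole disc, because \<open>cmod (1 - z) \<le> cmod (1 - expneg a * z) + l\<close>.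
Using either lower bound for both factors of the square yields the two terms of the
minimum. The estimate sees \<open>z\<close> only through \<open>s\<close>, so the peaks of a lacunary set have a
uniformly bounded sum.
\<close>
lemma cmod_peak_le:
  assumes a: "0 < a" "a \<le> A" and z: "z \<in> ball 0 1"
  shows "cmod (peak a z) \<le> 4 * exp A * ratio_kernel a (cmod (1 - z))"
proof -
  define l where "l = 1 - exp (- a)"
  define s where "s = cmod (1 - z)"
  define d where "d = cmod (1 - expneg a * z)"
  have l: "0 < l" "l \<le> a" "exp (- A) * a \<le> l"
    using a one_minus_exp_neg_le[of a] exp_neg_mult_le[of a A] by (auto simp: l_def)
  have "1 - z \<noteq> 0" using z by auto
  then have s: "0 < s" by (simp add: s_def)
  have cz: "cmod z < 1" using z by simp
  have "1 - exp (- a) * 1 \<le> 1 - cmod (expneg a * z)"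
    using cz by (simp add: norm_mult expneg_def)
  also have "\<dots> \<le> d" unfolding d_def by (rule order_trans[OF _ norm_triangle_ineq2]) simp
  finally have dl: "l \<le> d" by (simp add: l_def)
  have "s \<le> d + cmod (expneg a * z - z)"
    unfolding s_def d_def by (rule order_trans[OF _ norm_triangle_ineq]) simp
  also have "expneg a * z - z = complex_of_real (- l) * z"
    by (simp add: l_def expneg_def algebra_simps)
  also have "cmod \<dots> \<le> l"
    using cz l by (simp add: norm_mult)
  finally have ds: "s / 2 \<le> d" using dl by simp
  have K: "cmod (peak a z) = l * s / d\<^sup>2"
  proof -
    have "1 - expneg a = complex_of_real l" by (simp add: expneg_def l_def)
    then show ?thesis using l by (simp add: peak_def norm_mult norm_divide norm_power s_def d_def)
  qed
  have d: "0 < d" using dl l by linarith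
  have "l * s / d\<^sup>2 \<le> l * s / (s / 2)\<^sup>2"
    using ds s l d by (intro divide_left_mono power_mono) auto
  also have "\<dots> = 4 * (l / s)" using s by (simp add: power2_eq_square field_simps)
  also have "\<dots> \<le> 4 * (exp A * (a / s))"
  proof -
    have "1 * a \<le> exp A * a" using a by (intro mult_right_mono) auto
    then have "l \<le> exp A * a" using l by linarith
    then have "l / s \<le> (exp A * a) / s" using s by (intro divide_right_mono) auto
    then show ?thesis by simp
  qed
  finally have 1: "cmod (peak a z) \<le> 4 * (exp A * (a / s))" by (simp add: K)
  have "l * s / d\<^sup>2 \<le> l * s / l\<^sup>2"
    using dl s l d by (intro divide_left_mono power_mono) auto
  also have "\<dots> = s / l" using l by (simp add: power2_eq_square)
  also have "\<dots> \<le> s / (exp (- A) * a)"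
    using l a s by (intro divide_left_mono) auto
  also have "\<dots> = exp A * (s / a)" by (simp add: exp_minus field_simps)
  also have "\<dots> \<le> 4 * (exp A * (s / a))"
  proof -
    have "0 \<le> exp A * (s / a)" using s a by simp
    then show ?thesis by linarith
  qed
  finally have 2: "cmod (peak a z) \<le> 4 * (exp A * (s / a))" by (simp add: K)
  show ?thesis using 1 2 by (auto simp: ratio_kernel_def min_def s_def)
qed

lemma cmod_peak_self_ge:
  assumes "0 < a"
  shows "1 / 4 \<le> cmod (peak a (expneg a))"
proof -
  define x where "x = exp (- a)"
  have x: "0 < x" "x < 1" using assms by (auto simp: x_def)
  have "peak a (expneg a) = complex_of_real ((1 - x) * (1 - x) / (1 - x * x)\<^sup>2)"
    by (simp add: peak_def expneg_def x_def)
  also have "1 - x * x = (1 - x) * (1 + x)" by (simp add: algebra_simps)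
  also have "(1 - x) * (1 - x) / ((1 - x) * (1 + x))\<^sup>2 = 1 / (1 + x)\<^sup>2"
    using x by (simp add: power_mult_distrib power2_eq_square)
  finally have "cmod (peak a (expneg a)) = 1 / (1 + x)\<^sup>2"
    using x by (simp only: norm_of_real) simp
  also have "\<dots> \<ge> 1 / 2\<^sup>2" using x by (intro divide_left_mono power_mono) auto
  finally show ?thesis by simp
qed

text \<open>
The function \<open>1 - (\<Prod>i\<in>I. 1 - f i)\<close> takes the value 1 wherever some \<open>f i\<close> is 1 and the value 0
wherever all of them vanish, so it merges functions that are 1 at a single point each into
one that is 1 at all these points. This avoids interpolating at points of a block, where
divided differences would blow up as the points approach each other. The lemma shows that the
merged function is no larger than a constant multiple of the sum.
\<close>
lemma norm_one_minus_prod_one_minus_le: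
  fixes f :: "'i \<Rightarrow> complex"
  assumes "finite I" "0 \<le> C" "\<And>i. i \<in> I \<Longrightarrow> cmod (f i) \<le> C"
  shows "cmod (1 - (\<Prod>i\<in>I. 1 - f i)) \<le> (1 + C) ^ card I * (\<Sum>i\<in>I. cmod (f i))"
  using assms(1,3)
proof (induction I rule: finite_induct)
  case empty
  then show ?case by simp
next
  case (insert j I)
  let ?P = "\<Prod>i\<in>I. 1 - f i"
  have P: "cmod ?P \<le> (1 + C) ^ card I"
  proof -
    have "cmod ?P \<le> (\<Prod>i\<in>I. cmod (1 - f i))" by (simp add: prod_norm)
    also have "\<dots> \<le> (\<Prod>i\<in>I. 1 + C)"
    proof (intro prod_mono conjI)
      fix i assume "i \<in> I"
      then show "cmod (1 - f i) \<le> 1 + C"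
        using norm_triangle_ineq4[of 1 "f i"] insert.prems[of i] by simp
    qed auto
    finally show ?thesis by simp
  qed
  have "cmod (1 - (\<Prod>i\<in>insert j I. 1 - f i)) = cmod ((1 - ?P) + ?P * f j)"
    using insert.hyps by (simp add: algebra_simps)
  also have "\<dots> \<le> cmod (1 - ?P) + cmod ?P * cmod (f j)"
    by (metis norm_triangle_ineq norm_mult)
  also have "\<dots> \<le> (1 + C) ^ card I * (\<Sum>i\<in>I. cmod (f i)) + (1 + C) ^ card I * cmod (f j)"
    using insert P by (intro add_mono mult_right_mono) auto
  also have "\<dots> = (1 + C) ^ card I * (\<Sum>i\<in>insert j I. cmod (f i))"
    using insert.hyps by (simp add: algebra_simps)
  also have "\<dots> \<le> (1 + C) ^ card (insert j I) * (\<Sum>i\<in>insert j I. cmod (f i))"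
    using insert.hyps \<open>0 \<le> C\<close> by (intro mult_right_mono power_increasing sum_nonneg) auto
  finally show ?case .
qed

section \<open>Blocks separated on the logarithmic scale\<close>

text \<open>
The properties that the partition must have in the parameter \<open>a\<close> of \<open>expneg a\<close>. Apart from the upper bound
\<open>A\<close> they speak of ratios only, hence are inherited by every multiple of the family; this
is why one partition serves both a set of points and its image under a power map.
\<close>
locale log_blocks =
  fixes T :: "nat \<Rightarrow> real set" and N :: nat and A q \<eta> :: real
  assumes nonempty: "T n \<noteq> {}"
    and finite_block: "finite (T n)"
    and card_block: "card (T n) \<le> N"
    and pos: "a \<in> T n \<Longrightarrow> 0 < a"
    and le_A: "a \<in> T n \<Longrightarrow> a \<le> A"
    and disjoint: "m \<noteq> n \<Longrightarrow> T m \<inter> T n = {}"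
    and gap: "m \<noteq> n \<Longrightarrow> a \<in> T m \<Longrightarrow> b \<in> T n \<Longrightarrow> a < b \<Longrightarrow> q * a \<le> b"
    and tight: "a \<in> T n \<Longrightarrow> b \<in> T n \<Longrightarrow> b < (1 + \<eta>) * a"
    and q_gt_1: "1 < q" and \<eta>_lt_1: "\<eta> < 1"
begin

definition mass :: real where "mass = 2 * (q / (q - 1))"

text \<open>
The bound of \<open>rho_expneg_ge\<close> at the smallest ratio \<open>q\<close> between different blocks.
\<close>
definition \<kappa> :: real where "\<kappa> = exp (- A) / 2 * (1 - 1 / q)"

text \<open>
The exponent in the lower bound for products of distances. A single distance costs at most
\<open>2 * exp A / \<kappa>\<close> times the kernel; the other factor 2 and \<open>N\<close> account for replacing
the points of a block by one representative.
\<close>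
definition loss :: real where "loss = real N * (2 * (2 * exp A / \<kappa>)) * mass"

lemma \<kappa>_pos: "0 < \<kappa>"
  using q_gt_1 by (simp add: \<kappa>_def)

lemma comparable:
  assumes "a \<in> T n" "b \<in> T n"
  shows "a \<le> 2 * b"
proof -
  have "a < (1 + \<eta>) * b" using tight assms by blast
  also have "\<dots> \<le> 2 * b" using \<eta>_lt_1 pos[OF assms(2)] by (intro mult_right_mono) auto
  finally show ?thesis by simp
qed

lemma sum_ratio_kernel_selection_le:
  assumes "finite J" "0 < s" "\<And>n. c n \<in> T n"
  shows "(\<Sum>n\<in>J. ratio_kernel (c n) s) \<le> mass"
proof -
  have inj: "inj_on c J"
    using assms(3) disjoint by (metis disjoint_iff inj_onI)
  then have "(\<Sum>n\<in>J. ratio_kernel (c n) s) = (\<Sum>a\<in>c ` J. ratio_kernel a s)"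
    by (simp add: sum.reindex)
  also have "\<dots> \<le> mass"
    unfolding mass_def
  proof (rule sum_ratio_kernel_lacunary_le)
    fix a b assume "a \<in> c ` J" "b \<in> c ` J" "a < b"
    then obtain m n where "a = c m" "b = c n" by blast
    moreover from this \<open>a < b\<close> have "m \<noteq> n" by auto
    ultimately show "q * a \<le> b" using gap assms(3) \<open>a < b\<close> by blast
  qed (use assms q_gt_1 pos in auto)
  finally show ?thesis .
qed

lemma rho_separated:
  assumes "m \<noteq> n" "a \<in> T m" "b \<in> T n"
  shows "\<kappa> \<le> rho (expneg a) (expneg b)"
proof -
  have main: "\<kappa> \<le> rho (expneg a) (expneg b)"
    if "m \<noteq> n" "a \<in> T m" "b \<in> T n" "a < b" for a b m n
  proof -
    have "q * a \<le> b" using gap that by blast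
    moreover have "0 < a" "b \<le> A" using that pos le_A by auto
    ultimately have "a / b \<le> 1 / q" using q_gt_1 \<open>a < b\<close> by (simp add: field_simps)
    then have "\<kappa> \<le> exp (- A) / 2 * (1 - a / b)"
      unfolding \<kappa>_def by (intro mult_left_mono) auto
    also have "\<dots> \<le> rho (expneg a) (expneg b)"
      using \<open>0 < a\<close> \<open>a < b\<close> \<open>b \<le> A\<close> by (intro rho_expneg_ge) auto
    finally show ?thesis .
  qed
  have "a \<noteq> b" using assms disjoint by blast
  then show ?thesis
    using main[of m n a b] main[of n m b a] assms rho_commute[of "expneg a"]
    by (metis linorder_neqE_linordered_idom)
qed

lemma rho_ge_exp:
  assumes "m \<noteq> n" "a \<in> T m" "b \<in> T n"
  shows "exp (- (2 * exp A / \<kappa> * ratio_kernel a b)) \<le> rho (expneg a) (expneg b)"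
proof -
  have "exp (- (2 * exp A * ratio_kernel a b / \<kappa>)) \<le> rho (expneg a) (expneg b)"
    using assms pos le_A
    by (intro exp_neg_le_of_one_minus_le \<kappa>_pos rho_separated[OF assms] rho_le_1
        one_minus_rho_expneg_le expneg_in_ball) auto
  then show ?thesis by simp
qed

text \<open>
By the bound for single distances the product is at least the exponential of minus a constant times
the kernel sum over all points involved. Within one block the kernel varies by a factor of
at most 2, so this sum is at most \<open>2 * N\<close> times the one over block representatives,
which is bounded by \<open>mass\<close>.
\<close>
lemma prod_rho_other_blocks_ge:
  assumes "finite J" "n \<notin> J" "b \<in> T n"
  shows "exp (- loss) \<le> (\<Prod>m\<in>J. \<Prod>a\<in>T m. rho (expneg a) (expneg b))"
proof -
  define c where "c m = (SOME a. a \<in> T m)" for m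
  have c: "c m \<in> T m" for m using nonempty[of m] by (auto simp: c_def some_in_eq)
  define w where "w = 2 * exp A / \<kappa>"
  have w: "0 < w" using \<kappa>_pos by (simp add: w_def)
  have b: "0 < b" using assms pos by blast
  have block: "exp (- (real N * (2 * w) * ratio_kernel (c m) b)) \<le> (\<Prod>a\<in>T m. rho (expneg a) (expneg b))"
    if "m \<in> J" for m
  proof -
    have "m \<noteq> n" using that assms by blast
    have nn: "0 \<le> ratio_kernel (c m) b" using b c pos by (intro ratio_kernel_nonneg) auto
    have "(\<Sum>a\<in>T m. w * ratio_kernel a b) \<le> (\<Sum>a\<in>T m. w * (2 * ratio_kernel (c m) b))"
      using w b pos c comparable[OF _ c] comparable[OF c]
      by (intro sum_mono mult_left_mono ratio_kernel_comparable) auto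
    also have "\<dots> = real (card (T m)) * (2 * w * ratio_kernel (c m) b)" by simp
    also have "\<dots> \<le> real N * (2 * w * ratio_kernel (c m) b)"
      using card_block w nn by (intro mult_right_mono) auto
    finally have "exp (- (real N * (2 * w) * ratio_kernel (c m) b)) \<le>
        exp (\<Sum>a\<in>T m. - (w * ratio_kernel a b))" by (simp add: sum_negf mult.assoc)
    also have "\<dots> = (\<Prod>a\<in>T m. exp (- (w * ratio_kernel a b)))"
      using finite_block by (simp add: exp_sum)
    also have "\<dots> \<le> (\<Prod>a\<in>T m. rho (expneg a) (expneg b))"
      using rho_ge_exp[OF \<open>m \<noteq> n\<close> _ assms(3)] by (intro prod_mono) (auto simp: w_def)
    finally show ?thesis .
  qed
  have "real N * (2 * w) * (\<Sum>m\<in>J. ratio_kernel (c m) b) \<le> real N * (2 * w) * mass"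
    using sum_ratio_kernel_selection_le[OF assms(1) b c] w by (intro mult_left_mono) auto
  then have "exp (- loss) \<le> exp (\<Sum>m\<in>J. - (real N * (2 * w) * ratio_kernel (c m) b))"
    by (simp add: loss_def w_def sum_negf sum_distrib_left)
  also have "\<dots> = (\<Prod>m\<in>J. exp (- (real N * (2 * w) * ratio_kernel (c m) b)))"
    using assms(1) by (simp add: exp_sum)
  also have "\<dots> \<le> (\<Prod>m\<in>J. \<Prod>a\<in>T m. rho (expneg a) (expneg b))"
    using block by (intro prod_mono) auto
  finally show ?thesis .
qed

text \<open>
One-point blocks satisfy the same axioms with the same constants, so the product bound for
blocks applies to selections as well.
\<close>
lemma selection:
  assumes "\<And>n. c n \<in> T n"
  shows "log_blocks (\<lambda>n. {c n}) N A q \<eta>"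
proof
  have "card {c n} \<le> card (T n)" for n
    using assms finite_block by (intro card_mono) auto
  then show "card {c n} \<le> N" for n using card_block order_trans by blast
  show "{c m} \<inter> {c n} = {}" if "m \<noteq> n" for m n
    using disjoint[OF that] assms[of m] assms[of n] by auto
  show "a \<le> A" if "a \<in> {c n}" for a n using that le_A[OF assms[of n]] by simp
  show "b < (1 + \<eta>) * a" if "a \<in> {c n}" "b \<in> {c n}" for a b n
    using that tight[OF assms assms, of n] by simp
qed (use assms pos gap q_gt_1 \<eta>_lt_1 in auto)

lemma carleson_selection:
  assumes "\<And>n. c n \<in> T n"
  shows "carleson (\<lambda>n. expneg (c n)) \<and> exp (- loss) \<le> carleson_const (\<lambda>n. expneg (c n))"
proof -
  interpret sel: log_blocks "\<lambda>n. {c n}" N A q \<eta> using assms by (rule selection)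
  have sub: "range (\<lambda>n. expneg (c n)) \<subseteq> ball 0 1"
    using assms pos expneg_in_ball by blast
  have "exp (- loss) \<le> carleson_prod (\<lambda>n. expneg (c n)) j" for j
  proof (rule LIMSEQ_le_const[OF carleson_prod_LIMSEQ[OF sub]], intro exI allI impI)
    fix n show "exp (- loss) \<le> (\<Prod>i\<in>{..<n} - {j}. rho (expneg (c i)) (expneg (c j)))"
      using sel.prod_rho_other_blocks_ge[of "{..<n} - {j}" j "c j"]
      by (simp add: loss_def sel.loss_def mass_def sel.mass_def \<kappa>_def sel.\<kappa>_def)
  qed
  then have "exp (- loss) \<le> carleson_const (\<lambda>n. expneg (c n))"
    unfolding carleson_const_def by (intro cINF_greatest) auto
  moreover have "0 < exp (- loss)" by simp
  moreover have "inj (\<lambda>n. expneg (c n))"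
  proof (rule injI)
    fix m n assume "expneg (c m) = expneg (c n)"
    then have "c m = c n" using inj_expneg by (rule injD[rotated])
    then show "m = n" using disjoint[of m n] assms[of m] assms[of n] by auto
  qed
  ultimately show ?thesis using sub unfolding carleson_def by linarith
qed

text \<open>
The Blaschke product with zeros in all blocks but one. It is obtained from Montel's theorem
as a limit of finite products, which all have modulus at most 1; the zeros and the lower
bound on the remaining block hold for the finite products and pass to the limit.
\<close>
lemma blaschke_product_other_blocks:
  "\<exists>B. B holomorphic_on ball 0 1 \<and> (\<forall>z\<in>ball 0 1. cmod (B z) \<le> 1) \<and>
    (\<forall>m a. m \<noteq> n \<longrightarrow> a \<in> T m \<longrightarrow> B (expneg a) = 0) \<and>
    (\<forall>b\<in>T n. exp (- loss) \<le> cmod (B (expneg b)))"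
proof -
  define P where "P k z = (\<Prod>m\<in>{..<k} - {n}. \<Prod>a\<in>T m. blaschke_factor a z)" for k z
  have cmod_P: "cmod (P k z) = (\<Prod>m\<in>{..<k} - {n}. \<Prod>a\<in>T m. rho (expneg a) z)" for k z
    by (simp add: P_def prod_norm[symmetric] cmod_blaschke_factor)
  have P_le: "cmod (P k z) \<le> 1" if "z \<in> ball 0 1" for k z
    unfolding cmod_P using that pos
    by (intro prod_le_1 conjI prod_nonneg rho_nonneg rho_le_1 expneg_in_ball ballI) auto
  have P_holo: "P k holomorphic_on ball 0 1" for k
    unfolding P_def using pos by (intro holomorphic_intros holomorphic_blaschke_factor) auto
  obtain B r where B: "B holomorphic_on ball 0 1" and r: "strict_mono (r :: nat \<Rightarrow> nat)"
    and lim: "\<And>z. z \<in> ball 0 1 \<Longrightarrow> (\<lambda>k. P (r k) z) \<longlonglongrightarrow> B z"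
  proof (rule Montel[of "ball 0 1" "range P" P])
    show "\<exists>M. \<forall>h\<in>range P. \<forall>z\<in>K. cmod (h z) \<le> M" if "K \<subseteq> ball 0 1" for K
      using P_le that by blast
  qed (use P_holo in auto)
  show ?thesis
  proof (intro exI[of _ B] conjI ballI allI impI)
    show "B holomorphic_on ball 0 1" by fact
    show "cmod (B z) \<le> 1" if "z \<in> ball 0 1" for z
      using tendsto_norm[OF lim[OF that]] P_le[OF that] by (intro LIMSEQ_le_const2) auto
    show "B (expneg a) = 0" if "m \<noteq> n" "a \<in> T m" for m a
    proof -
      have "P k (expneg a) = 0" if "m < k" for k
        unfolding P_def using \<open>m \<noteq> n\<close> \<open>a \<in> T m\<close> \<open>m < k\<close> finite_block
        by (intro prod_zero bexI[of _ m] bexI[of _ a]) (auto simp: blaschke_factor_def)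
      moreover have "k \<le> r k" for k using r by (rule seq_suble)
      ultimately have "\<forall>\<^sub>F k in sequentially. P (r k) (expneg a) = 0"
        by (intro eventually_sequentiallyI[of "Suc m"]) (metis Suc_le_lessD order_less_le_trans)
      then have "(\<lambda>k. P (r k) (expneg a)) \<longlonglongrightarrow> 0" by (rule tendsto_eventually)
      then show ?thesis
        using lim[OF expneg_in_ball[OF pos[OF \<open>a \<in> T m\<close>]]] LIMSEQ_unique by blast
    qed
    show "exp (- loss) \<le> cmod (B (expneg b))" if "b \<in> T n" for b
    proof (rule LIMSEQ_le_const[OF tendsto_norm[OF lim]])
      show "\<exists>k0. \<forall>k\<ge>k0. exp (- loss) \<le> cmod (P (r k) (expneg b))"
        unfolding cmod_P using prod_rho_other_blocks_ge[OF _ _ that] by simp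
    qed (use that pos expneg_in_ball in auto)
  qed
qed

text \<open>
For a point \<open>b\<close> of the block \<open>n\<close>, the function \<open>F n b\<close> is the product of the Blaschke product of the other blocks
and the peak function at \<open>b\<close>, normalised to be 1 at \<open>expneg b\<close>. Both normalising factors are bounded below, so
\<open>F n b\<close> is bounded by a multiple of the kernel at \<open>b\<close>. The functions of one block are merged
through \<open>1 - (\<Prod>b. 1 - F n b)\<close>, and the kernel sum over the blocks is bounded.
\<close>
lemma block_functions:
  "has_block_functions (\<Union>n. expneg ` T n) (\<lambda>n. expneg ` T n)"
proof -
  have "\<exists>B. \<forall>n. B n holomorphic_on ball 0 1 \<and> (\<forall>z\<in>ball 0 1. cmod (B n z) \<le> 1) \<and>
      (\<forall>m a. m \<noteq> n \<longrightarrow> a \<in> T m \<longrightarrow> B n (expneg a) = 0) \<and>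
      (\<forall>b\<in>T n. exp (- loss) \<le> cmod (B n (expneg b)))"
    by (rule choice[OF allI[OF blaschke_product_other_blocks]])
  then obtain B where all_B: "\<forall>n. B n holomorphic_on ball 0 1 \<and> (\<forall>z\<in>ball 0 1. cmod (B n z) \<le> 1) \<and>
      (\<forall>m a. m \<noteq> n \<longrightarrow> a \<in> T m \<longrightarrow> B n (expneg a) = 0) \<and>
      (\<forall>b\<in>T n. exp (- loss) \<le> cmod (B n (expneg b)))" ..
  have B: "B n holomorphic_on ball 0 1 \<and> (\<forall>z\<in>ball 0 1. cmod (B n z) \<le> 1) \<and>
      (\<forall>m a. m \<noteq> n \<longrightarrow> a \<in> T m \<longrightarrow> B n (expneg a) = 0) \<and>
      (\<forall>b\<in>T n. exp (- loss) \<le> cmod (B n (expneg b)))" for n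
    using all_B by (rule spec)
  define F where "F n b z = B n z * peak b z / (B n (expneg b) * peak b (expneg b))" for n b z
  define D where "D n z = 1 - (\<Prod>b\<in>T n. 1 - F n b z)" for n z
  \<comment> \<open>The factor 4 of the upper bound for the peak, divided by its value, at least 1/4, at
     its own point, and by the lower bound for the Blaschke product.\<close>
  define C where "C = 16 * exp A * exp loss"
  have C: "0 \<le> C" by (simp add: C_def)
  define c where "c m = (SOME a. a \<in> T m)" for m
  have c: "c m \<in> T m" for m using nonempty[of m] by (auto simp: c_def some_in_eq)
  have s: "0 < cmod (1 - z)" if "z \<in> ball 0 1" for z :: complex using that by auto
  have F_le: "cmod (F n b z) \<le> C * ratio_kernel b (cmod (1 - z))"
    if "b \<in> T n" "z \<in> ball 0 1" for n b z
  proof -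
    have "0 \<le> ratio_kernel b (cmod (1 - z))"
      using that s pos by (intro ratio_kernel_nonneg) auto
    moreover have "cmod (B n z * peak b z) \<le> 1 * (4 * exp A * ratio_kernel b (cmod (1 - z)))"
      unfolding norm_mult using B[of n] that pos le_A by (intro mult_mono cmod_peak_le) auto
    moreover have "exp (- loss) * (1 / 4) \<le> cmod (B n (expneg b) * peak b (expneg b))"
      unfolding norm_mult using B[of n] that pos by (intro mult_mono cmod_peak_self_ge) auto
    ultimately have "cmod (F n b z) \<le> (4 * exp A * ratio_kernel b (cmod (1 - z))) / (exp (- loss) * (1 / 4))"
      unfolding F_def norm_divide by (intro frac_le) auto
    also have "\<dots> = C * ratio_kernel b (cmod (1 - z))"
      by (simp add: C_def exp_minus field_simps)
    finally show ?thesis .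
  qed
  define M0 where "M0 = (1 + C) ^ N * (real N * (C * 2))"
  have M0: "0 \<le> M0" using C by (simp add: M0_def)
  have D_le: "cmod (D n z) \<le> M0 * ratio_kernel (c n) (cmod (1 - z))" if z: "z \<in> ball 0 1" for n z
  proof -
    have k0: "0 \<le> ratio_kernel (c n) (cmod (1 - z))"
      using s[OF z] pos[OF c] by (intro ratio_kernel_nonneg) auto
    have FC: "cmod (F n b z) \<le> C" if "b \<in> T n" for b
    proof -
      have "C * ratio_kernel b (cmod (1 - z)) \<le> C * 1"
        using C s[OF z] pos[OF that] by (intro mult_left_mono ratio_kernel_le_1) auto
      then show ?thesis using F_le[OF that z] by simp
    qed
    have "cmod (D n z) \<le> (1 + C) ^ card (T n) * (\<Sum>b\<in>T n. cmod (F n b z))"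
      unfolding D_def using finite_block C FC by (intro norm_one_minus_prod_one_minus_le) auto
    also have "(\<Sum>b\<in>T n. cmod (F n b z)) \<le> (\<Sum>b\<in>T n. C * (2 * ratio_kernel (c n) (cmod (1 - z))))"
    proof (rule sum_mono)
      fix b assume b: "b \<in> T n"
      have "C * ratio_kernel b (cmod (1 - z)) \<le> C * (2 * ratio_kernel (c n) (cmod (1 - z)))"
        using C s[OF z] pos b c comparable[OF b c] comparable[OF c b] by (intro mult_left_mono ratio_kernel_comparable) auto
      then show "cmod (F n b z) \<le> C * (2 * ratio_kernel (c n) (cmod (1 - z)))"
        using F_le[OF b z] by linarith
    qed
    also have "\<dots> = real (card (T n)) * (C * 2 * ratio_kernel (c n) (cmod (1 - z)))" by simp
    also have "(1 + C) ^ card (T n) * \<dots> \<le> (1 + C) ^ N * (real N * (C * 2 * ratio_kernel (c n) (cmod (1 - z))))"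
      using card_block[of n] C k0 by (intro mult_mono power_increasing) auto
    finally show ?thesis using C by (simp add: M0_def mult.assoc mult_left_mono)
  qed
  have partial: "(\<Sum>n<k. cmod (D n z)) \<le> M0 * mass" if z: "z \<in> ball 0 1" for k z
  proof -
    have "(\<Sum>n<k. cmod (D n z)) \<le> M0 * (\<Sum>n<k. ratio_kernel (c n) (cmod (1 - z)))"
      unfolding sum_distrib_left using D_le[OF z] by (intro sum_mono) auto
    also have "\<dots> \<le> M0 * mass"
      using sum_ratio_kernel_selection_le[OF _ s[OF z] c] M0 by (intro mult_left_mono) auto
    finally show ?thesis .
  qed
  have D_Hinf: "D n \<in> Hinf" for n
  proof -
    have "D n holomorphic_on ball 0 1"
      unfolding D_def F_def using B[of n] pos
      by (intro holomorphic_intros holomorphic_peak) auto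
    moreover have "bounded (D n ` ball 0 1)"
    proof (rule boundedI)
      fix w assume "w \<in> D n ` ball 0 1"
      then obtain z where z: "z \<in> ball 0 1" "w = D n z" by auto
      have "cmod (D n z) \<le> M0 * ratio_kernel (c n) (cmod (1 - z))" using D_le z by blast
      also have "\<dots> \<le> M0 * 1"
        using M0 s z pos[OF c] by (intro mult_left_mono ratio_kernel_le_1) auto
      finally show "norm w \<le> M0" using z by simp
    qed
    ultimately show ?thesis by (simp add: Hinf_def)
  qed
  have D_one: "D n w = 1" if "w \<in> expneg ` T n" for n w
  proof -
    from that obtain b where b: "b \<in> T n" "w = expneg b" by auto
    have "B n (expneg b) \<noteq> 0" using B[of n] b(1) by (metis exp_gt_zero norm_zero not_le)
    moreover have "peak b (expneg b) \<noteq> 0" using cmod_peak_self_ge[OF pos[OF b(1)]] by auto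
    ultimately have "F n b w = 1" by (simp add: F_def b)
    then show ?thesis unfolding D_def using b(1) finite_block by (auto intro: prod_zero)
  qed
  have D_zero: "D n w = 0" if "w \<in> (\<Union>n. expneg ` T n) - expneg ` T n" for n w
  proof -
    from that obtain m a where "a \<in> T m" "w = expneg a" "m \<noteq> n" by auto
    then have "B n w = 0" using B[of n] by blast
    then show ?thesis by (simp add: D_def F_def)
  qed
  have D_summable: "summable (\<lambda>n. cmod (D n z))" if "z \<in> ball 0 1" for z
    using partial[OF that] by (intro summableI_nonneg_bounded) auto
  have D_sum: "(\<Sum>n. cmod (D n z)) \<le> M0 * mass" if "z \<in> ball 0 1" for z
    using D_summable[OF that] partial[OF that] by (intro suminf_le_const)
  show ?thesis
    unfolding has_block_functions_def
    by (intro exI conjI allI ballI) (rule D_Hinf D_one D_zero D_summable D_sum; assumption)+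
qed

lemma disc_blocks:
  defines "\<tau> \<equiv> \<lambda>n. expneg ` T n"
  shows "partition_into (\<Union>n. \<tau> n) \<tau>" "blocks_card_le N \<tau>" "blocks_rho_less \<eta> \<tau>"
    "uniformly_carleson_selections \<tau>" "has_block_functions (\<Union>n. \<tau> n) \<tau>"
proof -
  show "partition_into (\<Union>n. \<tau> n) \<tau>"
    using nonempty disjoint
    by (auto simp: partition_into_def disjoint_family_on_def \<tau>_def simp flip: image_Int[OF inj_expneg])
  show "blocks_card_le N \<tau>"
    unfolding blocks_card_le_def \<tau>_def
    using finite_block card_block card_image_le order_trans by blast
  have "rho (expneg a) (expneg b) < \<eta>" if "a \<in> T n" "b \<in> T n" "a \<le> b" for a b n
  proof -
    have "rho (expneg a) (expneg b) \<le> b / a - 1"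
      using that pos by (intro rho_expneg_le) auto
    also have "\<dots> < \<eta>" using tight[OF that(1,2)] pos[OF that(1)] by (simp add: field_simps)
    finally show ?thesis .
  qed
  then show "blocks_rho_less \<eta> \<tau>"
    unfolding blocks_rho_less_def \<tau>_def using rho_commute by (metis imageE linear)
  show "uniformly_carleson_selections \<tau>"
    unfolding uniformly_carleson_selections_def
  proof (intro exI[of _ "exp (- loss)"] conjI allI impI)
    fix c assume "\<forall>n. c n \<in> \<tau> n"
    then have "\<forall>n. \<exists>a. a \<in> T n \<and> c n = expneg a" by (auto simp: \<tau>_def)
    then obtain a where a: "\<And>n. a n \<in> T n" "\<And>n. c n = expneg (a n)" by metis
    then have "c = (\<lambda>n. expneg (a n))" by auto
    then show "carleson c" "exp (- loss) \<le> carleson_const c"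
      using carleson_selection[of a] a(1) by auto
  qed simp
  show "has_block_functions (\<Union>n. \<tau> n) \<tau>"
    unfolding \<tau>_def by (rule block_functions)
qed

lemma scaled:
  assumes "0 < p"
  shows "log_blocks (\<lambda>n. (\<lambda>a. p * a) ` T n) N (p * A) q \<eta>"
proof
  show "card ((\<lambda>a. p * a) ` T n) \<le> N" for n
    using finite_block card_block card_image_le order_trans by blast
  show "q * a \<le> b"
    if mn: "m \<noteq> n" and a: "a \<in> (\<lambda>a. p * a) ` T m" and b: "b \<in> (\<lambda>a. p * a) ` T n" and "a < b" for m n a b
  proof -
    from a b obtain x y where xy: "x \<in> T m" "a = p * x" "y \<in> T n" "b = p * y" by blast
    then have "q * x \<le> y" using gap[OF mn] \<open>a < b\<close> assms by auto
    then have "p * (q * x) \<le> p * y" using assms by (intro mult_left_mono) auto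
    then show ?thesis using xy by (simp add: mult_ac)
  qed
  show "b < (1 + \<eta>) * a" if "a \<in> (\<lambda>a. p * a) ` T n" "b \<in> (\<lambda>a. p * a) ` T n" for n a b
  proof -
    from that obtain x y where xy: "x \<in> T n" "a = p * x" "y \<in> T n" "b = p * y" by blast
    then have "p * y < p * ((1 + \<eta>) * x)" using tight assms by (intro mult_strict_left_mono) auto
    then show ?thesis using xy by (simp add: mult_ac)
  qed
qed (use assms nonempty finite_block pos le_A disjoint q_gt_1 \<eta>_lt_1 in \<open>auto simp: disjoint_iff\<close>)

end

section \<open>Grouping a union of sparse sets\<close>

text \<open>
A window whose ratios stay below \<open>1 + \<delta>\<close> catches at most one point of each sparse set.
\<close>
lemma card_window_le:
  fixes X :: "nat \<Rightarrow> real set"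
  assumes "W \<subseteq> (\<Union>r\<in>{1..N}. X r)"
    and sparse: "\<And>r a b. r \<in> {1..N} \<Longrightarrow> a \<in> X r \<Longrightarrow> b \<in> X r \<Longrightarrow> a < b \<Longrightarrow> (1 + \<delta>) * a \<le> b"
    and narrow: "\<And>a b. a \<in> W \<Longrightarrow> b \<in> W \<Longrightarrow> b < (1 + \<delta>) * a"
  shows "finite W" "card W \<le> N"
proof -
  have W: "W = (\<Union>r\<in>{1..N}. W \<inter> X r)" using assms(1) by auto
  have one: "finite (W \<inter> X r) \<and> card (W \<inter> X r) \<le> 1" if r: "r \<in> {1..N}" for r
  proof -
    have eq: "a = b" if "a \<in> W \<inter> X r" "b \<in> W \<inter> X r" for a b
      using sparse[OF r, of a b] sparse[OF r, of b a] narrow[of a b] narrow[of b a] that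
      by (cases a b rule: linorder_cases) auto
    show ?thesis
    proof (cases "W \<inter> X r = {}")
      case False
      then obtain a where "a \<in> W \<inter> X r" by blast
      with eq have "W \<inter> X r = {a}" by blast
      then show ?thesis by simp
    qed simp
  qed
  show "finite W" by (subst W) (intro finite_UN_I finite_atLeastAtMost, use one in blast)
  have "card W \<le> (\<Sum>r\<in>{1..N}. card (W \<inter> X r))"
    by (subst W) (rule card_UN_le, simp)
  also have "\<dots> \<le> (\<Sum>r\<in>{1..N}. 1)" using one by (intro sum_mono) blast
  finally show "card W \<le> N" by simp
qed

text \<open>
Call a point a leader if no point follows it within the factor \<open>q\<close>, and put into one block all
points with the same next leader. Choosing \<open>q ^ N < 1 + min \<delta> \<eta>\<close> makes this work: among points
following each other within factors less than \<open>q\<close> there cannot be \<open>N + 1\<close> within a window of ratio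
\<open>q ^ N\<close>, so the next leader after \<open>a\<close> is at most \<open>q ^ N * a\<close>. Hence each block lies in such a window, which
bounds both its cardinality and its ratios, while leaders separate the blocks by the factor \<open>q\<close>.
\<close>
lemma exists_log_blocks:
  fixes X :: "nat \<Rightarrow> real set" and N :: nat and A \<delta> \<eta> :: real
  defines "T \<equiv> (\<Union>r\<in>{1..N}. X r)"
  assumes N: "1 \<le> N" and \<delta>: "0 < \<delta>" and \<eta>: "0 < \<eta>" "\<eta> < 1"
    and sparse: "\<And>r a b. r \<in> {1..N} \<Longrightarrow> a \<in> X r \<Longrightarrow> b \<in> X r \<Longrightarrow> a < b \<Longrightarrow> (1 + \<delta>) * a \<le> b"
    and T_pos: "\<And>a. a \<in> T \<Longrightarrow> 0 < a" and T_le: "\<And>a. a \<in> T \<Longrightarrow> a \<le> A"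
    and inf: "infinite T" and count: "countable T"
  obtains B q where "log_blocks B N A q \<eta>" "(\<Union>n. B n) = T"
proof -
  define q where "q = root N (1 + min \<delta> \<eta> / 2)"
  have qN: "q ^ N = 1 + min \<delta> \<eta> / 2"
    unfolding q_def using N \<delta> \<eta> by (intro real_root_pow_pos2) auto
  have q: "1 < q"
    unfolding q_def using N \<delta> \<eta> by (simp add: real_root_gt_1_iff)
  have qN_less: "q ^ N < 1 + \<delta>" "q ^ N < 1 + \<eta>" using \<delta> \<eta> by (auto simp: qN min_def)
  have window: "finite W \<and> card W \<le> N" if "W \<subseteq> T" "W \<subseteq> {a..q ^ N * a}" "0 < a" for W a
  proof -
    have "y < (1 + \<delta>) * x" if "x \<in> W" "y \<in> W" for x y
    proof -
      have "y \<le> q ^ N * a" using that \<open>W \<subseteq> {a..q ^ N * a}\<close> by auto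
      also have "\<dots> < (1 + \<delta>) * a" using qN_less \<open>0 < a\<close> by (intro mult_strict_right_mono) auto
      also have "\<dots> \<le> (1 + \<delta>) * x"
        using that \<open>W \<subseteq> {a..q ^ N * a}\<close> \<delta> by (intro mult_left_mono) auto
      finally show ?thesis .
    qed
    then show ?thesis using card_window_le[of W X N \<delta>] sparse \<open>W \<subseteq> T\<close> unfolding T_def by blast
  qed
  define leader where "leader t \<longleftrightarrow> t \<in> T \<and> (\<forall>b\<in>T. t < b \<longrightarrow> q * t \<le> b)" for t
  have ex_leader: "\<exists>t. leader t \<and> a \<le> t \<and> t \<le> q ^ N * a" if a: "a \<in> T" for a
  proof (rule ccontr)
    assume no: "\<nexists>t. leader t \<and> a \<le> t \<and> t \<le> q ^ N * a"
    have a0: "0 < a" using T_pos a .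
    \<comment> \<open>Without a leader in reach, each point has a successor within the factor \<open>q\<close>, so that
       \<open>k\<close> steps from \<open>a\<close> collect \<open>k + 1\<close> points; \<open>N\<close> steps overfill the window.\<close>
    have "\<exists>b\<in>T. a \<le> b \<and> b \<le> q ^ k * a \<and> Suc k \<le> card (T \<inter> {a..b})" if "k \<le> N" for k
      using that
    proof (induction k)
      case 0
      have "T \<inter> {a..a} = {a}" using a by auto
      then show ?case using a by (intro bexI[of _ a]) auto
    next
      case (Suc k)
      then obtain b where b: "b \<in> T" "a \<le> b" "b \<le> q ^ k * a" "Suc k \<le> card (T \<inter> {a..b})" by auto
      have "q ^ k \<le> q ^ N" using q Suc.prems by (intro power_increasing) auto
      then have "q ^ k * a \<le> q ^ N * a" using a0 by (intro mult_right_mono) auto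
      then have "\<not> leader b" using no b by force
      then obtain b' where b': "b' \<in> T" "b < b'" "b' < q * b"
        using b(1) by (force simp: leader_def)
      have "q * b \<le> q * (q ^ k * a)" using b q by (intro mult_left_mono) auto
      then have le: "b' \<le> q ^ Suc k * a" using b' by (simp add: mult.assoc)
      have "q ^ Suc k \<le> q ^ N" using q Suc.prems by (intro power_increasing) auto
      then have "q ^ Suc k * a \<le> q ^ N * a" using a0 by (intro mult_right_mono) auto
      then have "b' \<le> q ^ N * a" using le by linarith
      then have "T \<inter> {a..b'} \<subseteq> {a..q ^ N * a}" by (intro subsetI) simp
      then have fin: "finite (T \<inter> {a..b'})" using window[OF Int_lower1 _ a0] by blast
      have "insert b' (T \<inter> {a..b}) \<subseteq> T \<inter> {a..b'}" using b b' by auto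
      then have "card (insert b' (T \<inter> {a..b})) \<le> card (T \<inter> {a..b'})" using fin by (rule card_mono[rotated])
      moreover have "finite (T \<inter> {a..b})" using fin b' by (rule_tac finite_subset[of _ "T \<inter> {a..b'}"]) auto
      ultimately have "Suc (Suc k) \<le> card (T \<inter> {a..b'})" using b b' by simp
      then show ?case using b' b le by (intro bexI[of _ b']) auto
    qed
    from this[of N] obtain b where "b \<le> q ^ N * a" "Suc N \<le> card (T \<inter> {a..b})" by auto
    moreover from this have "T \<inter> {a..b} \<subseteq> {a..q ^ N * a}" by (intro subsetI) simp
    ultimately show False using window[OF Int_lower1 _ a0, of "{a..b}"] by simp
  qed
  define top where "top a = Min {t. leader t \<and> a \<le> t \<and> t \<le> q ^ N * a}" for a
  have fin: "finite {t. leader t \<and> a \<le> t \<and> t \<le> q ^ N * a}" if "a \<in> T" for a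
  proof -
    have "{t. leader t \<and> a \<le> t \<and> t \<le> q ^ N * a} \<subseteq> T" by (auto simp: leader_def)
    moreover have "{t. leader t \<and> a \<le> t \<and> t \<le> q ^ N * a} \<subseteq> {a..q ^ N * a}"
      by (intro subsetI) simp
    ultimately show ?thesis using window T_pos[OF that] by blast
  qed
  have top: "leader (top a)" "a \<le> top a" "top a \<le> q ^ N * a" if "a \<in> T" for a
    using Min_in[OF fin[OF that]] ex_leader[OF that] by (auto simp: top_def)
  have top_le: "top a \<le> t" if "a \<in> T" "leader t" "a \<le> t" for a t
  proof (cases "t \<le> q ^ N * a")
    case True
    then show ?thesis unfolding top_def using fin that by (intro Min_le) auto
  next
    case False
    then show ?thesis using top(3)[OF that(1)] by linarith
  qed
  define blk where "blk t = {a \<in> T. top a = t}" for t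
  have blk: "finite (blk t) \<and> card (blk t) \<le> N" "a \<in> blk t \<Longrightarrow> b \<in> blk t \<Longrightarrow> b < (1 + \<eta>) * a" for t a b
  proof -
    have tight: "b \<le> q ^ N * a" if "a \<in> blk t" "b \<in> blk t" for a b t
      using that top[of a] top[of b] by (auto simp: blk_def)
    then show "b < (1 + \<eta>) * a" if "a \<in> blk t" "b \<in> blk t"
    proof -
      have "q ^ N * a < (1 + \<eta>) * a"
        using that T_pos[of a] qN_less by (intro mult_strict_right_mono) (auto simp: blk_def)
      then show ?thesis using tight[OF that] by linarith
    qed
    have sub: "blk t \<subseteq> {t / q ^ N..t}"
    proof
      fix a assume "a \<in> blk t"
      then show "a \<in> {t / q ^ N..t}"
        using top[of a] q by (auto simp: blk_def divide_le_eq mult.commute)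
    qed
    show "finite (blk t) \<and> card (blk t) \<le> N"
    proof (cases "blk t = {}")
      case False
      then have "0 < t" using top T_pos by (force simp: blk_def leader_def)
      then have "0 < t / q ^ N" using q by simp
      moreover have "blk t \<subseteq> T" by (auto simp: blk_def)
      moreover have "blk t \<subseteq> {t / q ^ N..q ^ N * (t / q ^ N)}" using sub q by simp
      ultimately show ?thesis using window by blast
    qed simp
  qed
  have T_blk: "T = (\<Union>t\<in>Collect leader. blk t)" using top by (auto simp: blk_def)
  then have "infinite (Collect leader)" using inf blk(1) by (metis finite_UN_I)
  moreover have "countable (Collect leader)"
    using count by (rule countable_subset[rotated]) (auto simp: leader_def)
  ultimately have e: "bij_betw (from_nat_into (Collect leader)) UNIV (Collect leader)"
    by (rule bij_betw_from_nat_into[rotated])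
  define e where "e = from_nat_into (Collect leader)"
  have e_leader: "leader (e n)" for n using e by (auto simp: e_def bij_betw_def)
  have e_inj: "e m \<noteq> e n" if "m \<noteq> n" for m n using e that by (auto simp: e_def bij_betw_def inj_def)
  have e_range: "range e = Collect leader" using e by (auto simp: e_def bij_betw_def)
  have "log_blocks (\<lambda>n. blk (e n)) N A q \<eta>"
  proof
    show "blk (e n) \<noteq> {}" for n
    proof -
      have "e n \<in> T" using e_leader by (auto simp: leader_def)
      then have "top (e n) = e n" using top(2) top_le e_leader by (intro antisym) auto
      then show ?thesis using \<open>e n \<in> T\<close> by (auto simp: blk_def)
    qed
    show "q * a \<le> b" if "m \<noteq> n" "a \<in> blk (e m)" "b \<in> blk (e n)" "a < b" for m n a b
    proof -
      have ab: "a \<in> T" "b \<in> T" "top a = e m" "top b = e n" using that by (auto simp: blk_def)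
      \<comment> \<open>Otherwise the leader \<open>top a\<close> lies above both points, and they share it.\<close>
      have "top a < b"
      proof (rule ccontr)
        assume "\<not> top a < b"
        then have "top b \<le> top a" using top_le[of b "top a"] top(1)[of a] ab by auto
        moreover have "top a \<le> top b"
          using top_le[of a "top b"] top[of b] ab \<open>a < b\<close> by auto
        ultimately show False using e_inj[OF \<open>m \<noteq> n\<close>] ab by auto
      qed
      then have "q * top a \<le> b" using top(1)[of a] ab by (auto simp: leader_def)
      moreover have "q * a \<le> q * top a" using top(2)[of a] ab q by (intro mult_left_mono) auto
      ultimately show ?thesis by linarith
    qed
  qed (use blk q \<eta> T_pos T_le e_inj in \<open>auto simp: blk_def\<close>)
  moreover have "(\<Union>n. blk (e n)) = T" using T_blk e_range by (metis image_image)
  ultimately show thesis by (rule that)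
qed

section \<open>Carleson sequences on the radius\<close>

lemma carleson_const_le_rho:
  assumes "carleson s" "i \<noteq> j"
  shows "carleson_const s \<le> rho (s i) (s j)"
proof -
  have sub: "range s \<subseteq> ball 0 1" using assms by (simp add: carleson_def)
  have prod_nonneg: "0 \<le> carleson_prod s k" for k
    by (rule LIMSEQ_le_const[OF carleson_prod_LIMSEQ[OF sub]]) (auto intro!: prod_nonneg rho_nonneg)
  have "carleson_const s \<le> carleson_prod s j"
    unfolding carleson_const_def using prod_nonneg by (intro cINF_lower bdd_belowI2) auto
  also have "\<dots> \<le> rho (s i) (s j)"
  proof (rule LIMSEQ_le_const2[OF carleson_prod_LIMSEQ[OF sub]], intro exI allI impI)
    fix n assume "Suc i \<le> n"
    then have "i \<in> {..<n} - {j}" using assms by auto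
    then have "(\<Prod>k\<in>{..<n} - {j}. rho (s k) (s j)) =
        rho (s i) (s j) * (\<Prod>k\<in>{..<n} - {j} - {i}. rho (s k) (s j))"
      by (intro prod.remove) auto
    also have "\<dots> \<le> rho (s i) (s j) * 1"
      using sub by (intro mult_left_mono prod_le_1 conjI rho_nonneg rho_le_1) blast+
    finally show "(\<Prod>k\<in>{..<n} - {j}. rho (s k) (s j)) \<le> rho (s i) (s j)" by simp
  qed
  finally show ?thesis .
qed

definition neg_log :: "complex \<Rightarrow> real" where
  "neg_log z = - ln (Re z)"

lemma expneg_neg_log:
  assumes "z \<in> complex_of_real ` {0<..<1}"
  shows "expneg (neg_log z) = z" "0 < neg_log z"
  using assms by (auto simp: expneg_def neg_log_def)

lemma carleson_neg_log_sparse: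
  assumes s: "carleson s" "range s \<subseteq> complex_of_real ` {0<..<1}"
    and ab: "a \<in> neg_log ` range s" "b \<in> neg_log ` range s" "a < b"
  shows "carleson_const s \<le> rho (expneg a) (expneg b)" "(1 + carleson_const s) * a \<le> b"
proof -
  from ab obtain i j where ij: "a = neg_log (s i)" "b = neg_log (s j)" by auto
  have E: "expneg a = s i" "expneg b = s j" "0 < a"
    using expneg_neg_log s(2) unfolding ij by blast+
  have "i \<noteq> j" using ij \<open>a < b\<close> by auto
  then show le: "carleson_const s \<le> rho (expneg a) (expneg b)"
    unfolding E using carleson_const_le_rho s(1) by blast
  also have "\<dots> \<le> b / a - 1" using E(3) \<open>a < b\<close> by (intro rho_expneg_le) auto
  finally show "(1 + carleson_const s) * a \<le> b" using E by (simp add: field_simps)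
qed

text \<open>
If the larger of two points is some small \<open>x\<close>, their distance is at most \<open>x / (1 - x)\<close>. Separation by
\<open>d = carleson_const s\<close> thus allows at most one point below \<open>d / (1 + d)\<close>, so the sequence keeps away from
0. The cases distinguish whether such an exceptional point exists.
\<close>
lemma carleson_neg_log_bounded:
  assumes s: "carleson s" "range s \<subseteq> complex_of_real ` {0<..<1}"
  shows "\<exists>A. \<forall>a\<in>neg_log ` range s. a \<le> A"
proof (cases "\<exists>a0\<in>neg_log ` range s. exp (- a0) * (1 + carleson_const s) < carleson_const s")
  case False
  have d: "0 < carleson_const s" using s by (simp add: carleson_def)
  have "a \<le> - ln (carleson_const s / (1 + carleson_const s))" if "a \<in> neg_log ` range s" for a
  proof -
    have "carleson_const s / (1 + carleson_const s) \<le> exp (- a)"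
      using False that d by (auto simp: divide_le_eq not_less)
    then have "ln (carleson_const s / (1 + carleson_const s)) \<le> - a"
      using d by (subst ln_exp[of "- a", symmetric], subst ln_le_cancel_iff) auto
    then show ?thesis by simp
  qed
  then show ?thesis by blast
next
  case True
  then obtain a0 where a0: "a0 \<in> neg_log ` range s" "exp (- a0) * (1 + carleson_const s) < carleson_const s"
    by blast
  have "a \<le> a0" if a: "a \<in> neg_log ` range s" for a
  proof (rule ccontr)
    assume "\<not> a \<le> a0"
    then have lt: "a0 < a" by simp
    have pos: "0 < a0" using a0 expneg_neg_log(2) s(2) by blast
    have "rho (expneg a0) (expneg a) \<le> exp (- a0) / (1 - exp (- a0))"
      unfolding rho_expneg[OF pos less_imp_le[OF lt]] using pos lt
      by (intro frac_le) (auto simp: mult_le_cancel_left)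
    also have "\<dots> < carleson_const s" using a0(2) pos by (simp add: divide_less_eq algebra_simps)
    finally show False using carleson_neg_log_sparse(1)[OF s a0(1) a lt] by simp
  qed
  then show ?thesis by blast
qed

theorem theorem2p5:
  fixes N :: nat and L :: "nat \<Rightarrow> nat \<Rightarrow> complex" and \<Lambda> :: "complex set" and p \<eta> :: real
  assumes "N \<ge> 1"
    and "\<And>r. r \<in> {1..N} \<Longrightarrow> carleson (L r)"
    and "\<Lambda> = (\<Union>r\<in>{1..N}. range (L r))"
    and "\<Lambda> \<subseteq> complex_of_real ` {0<..<1}"
    and "p > 0"
    and "0 < \<eta>" and "\<eta> < 1"
  shows "\<exists>\<sigma> :: nat \<Rightarrow> complex set.
           partition_into \<Lambda> \<sigma> \<and>
           partition_into (cpow p ` \<Lambda>) (\<lambda>n. cpow p ` \<sigma> n) \<and>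
           (\<forall>(\<Gamma>, \<tau>) \<in> {(\<Lambda>, \<sigma>), (cpow p ` \<Lambda>, \<lambda>n. cpow p ` \<sigma> n)}.
              blocks_card_le N \<tau> \<and>
              blocks_rho_less \<eta> \<tau> \<and>
              uniformly_carleson_selections \<tau> \<and>
              has_block_functions \<Gamma> \<tau>)"
proof -
  define X where "X r = neg_log ` range (L r)" for r
  define T where "T = (\<Union>r\<in>{1..N}. X r)"
  have T: "T = neg_log ` \<Lambda>" by (auto simp: T_def X_def assms(3))
  have \<Lambda>: "\<Lambda> = expneg ` T"
    using expneg_neg_log(1) assms(4) by (force simp: T image_image)
  have L: "range (L r) \<subseteq> complex_of_real ` {0<..<1}" if "r \<in> {1..N}" for r
    using assms(3,4) that by blast
  define \<delta> where "\<delta> = Min ((\<lambda>r. carleson_const (L r)) ` {1..N})"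
  have \<delta>: "0 < \<delta>"
    using assms(1,2) by (auto simp: \<delta>_def carleson_def)
  have sparse: "(1 + \<delta>) * a \<le> b"
    if r: "r \<in> {1..N}" and ab: "a \<in> X r" "b \<in> X r" "a < b" for r a b
  proof -
    have "0 < a" using ab(1) expneg_neg_log(2) L[OF r] by (auto simp: X_def)
    moreover have "\<delta> \<le> carleson_const (L r)" unfolding \<delta>_def using r by (intro Min_le) auto
    ultimately have "(1 + \<delta>) * a \<le> (1 + carleson_const (L r)) * a"
      by (intro mult_right_mono) auto
    also have "\<dots> \<le> b"
      using carleson_neg_log_sparse(2)[OF assms(2)[OF r] L[OF r]] ab by (simp add: X_def)
    finally show ?thesis .
  qed
  have "\<forall>r\<in>{1..N}. \<exists>A. \<forall>a\<in>X r. a \<le> A"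
    using carleson_neg_log_bounded assms(2) L by (simp add: X_def)
  then obtain A' where A': "\<And>r a. r \<in> {1..N} \<Longrightarrow> a \<in> X r \<Longrightarrow> a \<le> A' r" by metis
  define A where "A = Max (A' ` {1..N})"
  have T_le: "a \<le> A" if "a \<in> T" for a
  proof -
    from that obtain r where r: "r \<in> {1..N}" "a \<in> X r" by (auto simp: T_def)
    then have "A' r \<le> A" unfolding A_def by (intro Max_ge) auto
    then show ?thesis using A'[OF r] by linarith
  qed
  have T_pos: "0 < a" if "a \<in> T" for a using that expneg_neg_log(2) assms(4) by (auto simp: T)
  have "infinite (range (L 1))"
    using assms(1,2) by (intro range_inj_infinite) (auto simp: carleson_def)
  then have "infinite \<Lambda>" using assms(1,3) by (auto intro: infinite_super)
  then have inf: "infinite T" using \<Lambda> by blast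
  have count: "countable T" by (auto simp: T_def X_def)
  obtain B q where B: "log_blocks B N A q \<eta>" and T_eq: "(\<Union>n. B n) = T"
    using exists_log_blocks[of N \<delta> \<eta> X A] assms(1,6,7) \<delta> sparse T_pos T_le inf count
    unfolding T_def by blast
  interpret B: log_blocks B N A q \<eta> by fact
  interpret pB: log_blocks "\<lambda>n. (\<lambda>a. p * a) ` B n" N "p * A" q \<eta>
    using assms(5) by (rule B.scaled)
  define \<sigma> where "\<sigma> n = expneg ` B n" for n
  have p\<sigma>: "(\<lambda>n. cpow p ` \<sigma> n) = (\<lambda>n. expneg ` (\<lambda>a. p * a) ` B n)"
    by (simp add: \<sigma>_def image_image cpow_expneg)
  have \<Lambda>_UN: "(\<Union>n. expneg ` B n) = \<Lambda>" by (simp add: \<Lambda> flip: T_eq image_UN)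
  then have p\<Lambda>: "(\<Union>n. expneg ` (\<lambda>a. p * a) ` B n) = cpow p ` \<Lambda>"
    by (simp add: image_UN image_image cpow_expneg flip: \<Lambda>_UN)
  note \<sigma>_props = B.disc_blocks[unfolded \<Lambda>_UN, folded \<sigma>_def]
  note p\<sigma>_props = pB.disc_blocks[unfolded p\<Lambda>, folded p\<sigma>]
  show ?thesis
    using \<sigma>_props p\<sigma>_props by (intro exI[of _ \<sigma>]) simp
qed

end
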